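(* Let $(D,\delta,\Pi)$ be a causal derivation--divergence triple satisfying the chain rule core, operator factorization and orthogonal projection assumptions. Let $F\in\mathrm{Dom}(D)$ and $u\in\mathrm{Dom}(\delta)$. Assume that the pointwise product $Fu:\Omega\to\mathcal H$, $(Fu)(\omega):=F(\omega)u(\omega)$, satisfies (1) $Fu\in L^2(\Omega;\mathcal H)$ and (2) $Fu\in\mathrm{Dom}(\delta)$. Then $$\delta(Fu)=F\delta(u)-\langle DF,u\rangle_{\mathcal H}\qquad\text{in }L^2(\Omega).$$
   Context: Let $(\Omega,\mathcal F,P)$ be a complete probability space with a filtration $(\mathcal F_t)_{t\in[0,T]}$ satisfying the usual conditions and $\mathcal H$ a separable real Hilbert space. A causal derivation--divergence triple $(D,\delta,\Pi)$ consists of: a densely defined closed linear operator $D:\mathrm{Dom}(D)\subset L^2(\Omega)\to L^2(\Omega;\mathcal H)$ with $\mathbf 1\in\mathrm{Dom}(D)$ and $D\mathbf 1=0$; its Hilbert space adjoint $\delta:\mathrm{Dom}(\delta)\subset L^2(\Omega;\mathcal H)\to L^2(\Omega)$, i.e. $\mathbb{E}[F\delta(u)]=\mathbb{E}[\langle DF,u\rangle_{\mathcal H}]$ for $F\in\mathrm{Dom}(D)$, $u\in\mathrm{Dom}(\delta)$; and a bounded projection $\Pi:L^2(\Omega;\mathcal H)\to L^2(\Omega;\mathcal H)$, $\Pi^2=\Pi$. Chain rule core: there exists a subalgebra $\mathcal A\subset\mathrm{Dom}(D)$, dense in $L^2(\Omega)$ and stable under multiplication, such that $D(\varphi(F))=\varphi'(F)DF$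 for $F\in\mathcal A$, $\varphi\in C^1_b(\mathbb{R})$, and $D(\varphi(F))=\sum_{i=1}^n\partial_i\varphi(F)DF_i$ for $\varphi\in C^1_b(\mathbb{R}^n)$ and $F=(F_1,\dots,F_n)$, $F_i\in\mathcal A$. Operator factorization: $F-\mathbb{E}[F]=\delta(\Pi DF)$ for $F\in\mathcal A$. Orthogonal projection: $\Pi=\Pi^*$.
   Formalization: The chain rule core assumption is strengthened: the algebra A is required to be dense in Dom(D) for the graph norm of D (a core of D), not only dense in L²(Ω); with L²-density alone the claim is false. *)

theory Defs
  imports "HOL-Probability.Probability"
begin

section \<open>Square-integrable functions\<close>

text \<open>
  Elements of \<open>L\<^sup>2(\<Omega>; H)\<close> are represented by square-integrable functions; equality in \<open>L\<^sup>2\<close> is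
  equality almost everywhere. A set of elements of \<open>L\<^sup>2\<close> is accordingly a set of representatives
  that is closed under almost everywhere equality.
\<close>

definition l2_space :: "'w measure \<Rightarrow> ('w \<Rightarrow> 'b::real_inner) set" where
  "l2_space M = {f \<in> borel_measurable M. integrable M (\<lambda>w. (norm (f w))\<^sup>2)}"

definition l2_inner :: "'w measure \<Rightarrow> ('w \<Rightarrow> 'b::real_inner) \<Rightarrow> ('w \<Rightarrow> 'b) \<Rightarrow> real" where
  "l2_inner M f g = (\<integral>w. f w \<bullet> g w \<partial>M)"

definition l2_norm :: "'w measure \<Rightarrow> ('w \<Rightarrow> 'b::real_inner) \<Rightarrow> real" where
  "l2_norm M f = sqrt (l2_inner M f f)"

definition l2_tendsto :: "'w measure \<Rightarrow> (nat \<Rightarrow> 'w \<Rightarrow> 'b::real_inner) \<Rightarrow> ('w \<Rightarrow> 'b) \<Rightarrow> bool" where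
  "l2_tendsto M f g \<longleftrightarrow> (\<lambda>n. l2_norm M (\<lambda>w. f n w - g w)) \<longlonglongrightarrow> 0"

definition l2_subspace :: "'w measure \<Rightarrow> ('w \<Rightarrow> 'b::real_inner) set \<Rightarrow> bool" where
  "l2_subspace M S \<longleftrightarrow>
     S \<subseteq> l2_space M \<and>
     (\<lambda>w. 0) \<in> S \<and>
     (\<forall>f\<in>S. \<forall>g\<in>S. (\<lambda>w. f w + g w) \<in> S) \<and>
     (\<forall>c. \<forall>f\<in>S. (\<lambda>w. c *\<^sub>R f w) \<in> S) \<and>
     (\<forall>f\<in>S. \<forall>g\<in>l2_space M. (AE w in M. f w = g w) \<longrightarrow> g \<in> S)"

definition l2_dense :: "'w measure \<Rightarrow> ('w \<Rightarrow> 'b::real_inner) set \<Rightarrow> bool" where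
  "l2_dense M S \<longleftrightarrow>
     S \<subseteq> l2_space M \<and>
     (\<forall>f\<in>l2_space M. \<forall>e>0. \<exists>g\<in>S. l2_norm M (\<lambda>w. f w - g w) < e)"


section \<open>Unbounded operators\<close>

text \<open>
  An operator is given by its domain and by a function whose values outside the domain are
  irrelevant.
\<close>

definition l2_operator ::
  "'w measure \<Rightarrow> ('w \<Rightarrow> 'a::real_inner) set \<Rightarrow> (('w \<Rightarrow> 'a) \<Rightarrow> ('w \<Rightarrow> 'b::real_inner)) \<Rightarrow> bool" where
  "l2_operator M S T \<longleftrightarrow>
     l2_subspace M S \<and>
     (\<forall>f\<in>S. T f \<in> l2_space M) \<and>
     (\<forall>f\<in>S. \<forall>g\<in>S. (AE w in M. f w = g w) \<longrightarrow> (AE w in M. T f w = T g w)) \<and>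
     (\<forall>f\<in>S. \<forall>g\<in>S. AE w in M. T (\<lambda>x. f x + g x) w = T f w + T g w) \<and>
     (\<forall>c. \<forall>f\<in>S. AE w in M. T (\<lambda>x. c *\<^sub>R f x) w = c *\<^sub>R T f w)"

definition l2_closed_operator ::
  "'w measure \<Rightarrow> ('w \<Rightarrow> 'a::real_inner) set \<Rightarrow> (('w \<Rightarrow> 'a) \<Rightarrow> ('w \<Rightarrow> 'b::real_inner)) \<Rightarrow> bool" where
  "l2_closed_operator M S T \<longleftrightarrow>
     l2_operator M S T \<and>
     (\<forall>f. \<forall>g\<in>l2_space M. \<forall>h\<in>l2_space M.
        (\<forall>n::nat. f n \<in> S) \<and> l2_tendsto M f g \<and> l2_tendsto M (\<lambda>n. T (f n)) h \<longrightarrow>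
        g \<in> S \<and> (AE w in M. T g w = h w))"

definition l2_bounded_operator ::
  "'w measure \<Rightarrow> (('w \<Rightarrow> 'a::real_inner) \<Rightarrow> ('w \<Rightarrow> 'b::real_inner)) \<Rightarrow> bool" where
  "l2_bounded_operator M T \<longleftrightarrow>
     l2_operator M (l2_space M) T \<and>
     (\<exists>C. \<forall>f\<in>l2_space M. l2_norm M (T f) \<le> C * l2_norm M f)"

text \<open>
  \<open>(S', T')\<close> is the Hilbert space adjoint of the densely defined operator \<open>(S, T)\<close>, with its full
  domain.
\<close>

definition l2_adjoint ::
  "'w measure \<Rightarrow> ('w \<Rightarrow> 'a::real_inner) set \<Rightarrow> (('w \<Rightarrow> 'a) \<Rightarrow> ('w \<Rightarrow> 'b::real_inner)) \<Rightarrow>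
   ('w \<Rightarrow> 'b) set \<Rightarrow> (('w \<Rightarrow> 'b) \<Rightarrow> ('w \<Rightarrow> 'a)) \<Rightarrow> bool" where
  "l2_adjoint M S T S' T' \<longleftrightarrow>
     S' = {u \<in> l2_space M. \<exists>y\<in>l2_space M. \<forall>f\<in>S. l2_inner M f y = l2_inner M (T f) u} \<and>
     (\<forall>u\<in>S'. T' u \<in> l2_space M \<and> (\<forall>f\<in>S. l2_inner M f (T' u) = l2_inner M (T f) u))"

text \<open>A core of an operator: a subset of the domain that is dense in it for the graph norm.\<close>

definition l2_core ::
  "'w measure \<Rightarrow> ('w \<Rightarrow> 'a::real_inner) set \<Rightarrow> ('w \<Rightarrow> 'a) set \<Rightarrow>
   (('w \<Rightarrow> 'a) \<Rightarrow> ('w \<Rightarrow> 'b::real_inner)) \<Rightarrow> bool" where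
  "l2_core M A S T \<longleftrightarrow>
     A \<subseteq> S \<and>
     (\<forall>f\<in>S. \<forall>e>0. \<exists>g\<in>A. l2_norm M (\<lambda>w. f w - g w) < e \<and> l2_norm M (\<lambda>w. T f w - T g w) < e)"


section \<open>Causal derivation--divergence triples\<close>

definition usual_filtration :: "'w measure \<Rightarrow> real \<Rightarrow> (real \<Rightarrow> 'w measure) \<Rightarrow> bool" where
  "usual_filtration M T Filt \<longleftrightarrow>
     (\<forall>t\<in>{0..T}. subalgebra M (Filt t)) \<and>
     (\<forall>s\<in>{0..T}. \<forall>t\<in>{0..T}. s \<le> t \<longrightarrow> sets (Filt s) \<subseteq> sets (Filt t)) \<and>
     null_sets M \<subseteq> sets (Filt 0) \<and>
     (\<forall>t\<in>{0..<T}. sets (Filt t) = (\<Inter>s\<in>{t<..T}. sets (Filt s)))"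

locale causal_triple = prob_space M
  for M :: "'w measure" +
  fixes T :: real
    and Filt :: "real \<Rightarrow> 'w measure"
    and DomD :: "('w \<Rightarrow> real) set"
    and D :: "('w \<Rightarrow> real) \<Rightarrow> ('w \<Rightarrow> 'h::{real_inner, complete_space, second_countable_topology})"
    and Domdelta :: "('w \<Rightarrow> 'h) set"
    and \<delta> :: "('w \<Rightarrow> 'h) \<Rightarrow> ('w \<Rightarrow> real)"
    and Proj :: "('w \<Rightarrow> 'h) \<Rightarrow> ('w \<Rightarrow> 'h)"
  assumes complete: "complete_measure M"
    and horizon: "0 \<le> T"
    and filtration: "usual_filtration M T Filt"
    and D_closed: "l2_closed_operator M DomD D"
    and D_dense: "l2_dense M DomD"
    and one_in_DomD: "(\<lambda>w. 1) \<in> DomD"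
    and D_one: "AE w in M. D (\<lambda>w. 1) w = 0"
    and adjoint: "l2_adjoint M DomD D Domdelta \<delta>"
    and Pi_bounded: "l2_bounded_operator M Proj"
    and Pi_idem: "\<forall>u\<in>l2_space M. AE w in M. Proj (Proj u) w = Proj u w"

text \<open>
  \<open>\<phi> \<in> C\<^sup>1\<^sub>b(\<real>)\<close> with derivative \<open>\<phi>'\<close>; both the function and its derivative are bounded.
\<close>

definition C1b :: "(real \<Rightarrow> real) \<Rightarrow> (real \<Rightarrow> real) \<Rightarrow> bool" where
  "C1b \<phi> \<phi>' \<longleftrightarrow>
     (\<forall>x. (\<phi> has_real_derivative \<phi>' x) (at x)) \<and> continuous_on UNIV \<phi>' \<and>
     bounded (range \<phi>) \<and> bounded (range \<phi>')"

text \<open>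
  \<open>\<phi> \<in> C\<^sup>1\<^sub>b(\<real>\<^sup>n)\<close> with partial derivatives \<open>\<phi>' i\<close>, \<open>i < n\<close>. Since \<open>n\<close> is quantified in the chain rule,
  functions on \<open>\<real>\<^sup>n\<close> are represented by functions on \<open>nat \<Rightarrow> real\<close> that only depend on the first \<open>n\<close>
  coordinates. For such functions continuity in the product topology of \<open>nat \<Rightarrow> real\<close> is continuity
  on \<open>\<real>\<^sup>n\<close>.
\<close>

definition C1b_n ::
  "nat \<Rightarrow> ((nat \<Rightarrow> real) \<Rightarrow> real) \<Rightarrow> (nat \<Rightarrow> (nat \<Rightarrow> real) \<Rightarrow> real) \<Rightarrow> bool" where
  "C1b_n n \<phi> \<phi>' \<longleftrightarrow>
     (\<forall>x y. (\<forall>i<n. x i = y i) \<longrightarrow> \<phi> x = \<phi> y) \<and>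
     continuous_on UNIV \<phi> \<and> bounded (range \<phi>) \<and>
     (\<forall>i<n. (\<forall>x. ((\<lambda>t. \<phi> (x(i := t))) has_real_derivative \<phi>' i x) (at (x i))) \<and>
            continuous_on UNIV (\<phi>' i) \<and> bounded (range (\<phi>' i)))"

text \<open>
  The algebra is required to be a core of \<open>D\<close> in the operator-theoretic sense, besides being dense
  in \<open>L\<^sup>2(\<Omega>)\<close>. Density in \<open>L\<^sup>2(\<Omega>)\<close> alone does not constrain \<open>D\<close> off the algebra: a closed operator
  stays closed when its domain is enlarged by one element on which its value is chosen freely.
\<close>

definition chain_rule_core ::
  "'w measure \<Rightarrow> ('w \<Rightarrow> real) set \<Rightarrow> (('w \<Rightarrow> real) \<Rightarrow> ('w \<Rightarrow> 'h::real_inner)) \<Rightarrow>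
   ('w \<Rightarrow> real) set \<Rightarrow> bool" where
  "chain_rule_core M DomD D A \<longleftrightarrow>
     l2_subspace M A \<and>
     (\<forall>F\<in>A. \<forall>G\<in>A. (\<lambda>w. F w * G w) \<in> A) \<and>
     l2_dense M A \<and>
     l2_core M A DomD D \<and>
     (\<forall>F\<in>A. \<forall>\<phi> \<phi>'. C1b \<phi> \<phi>' \<longrightarrow>
        (\<lambda>w. \<phi> (F w)) \<in> DomD \<and>
        (AE w in M. D (\<lambda>x. \<phi> (F x)) w = \<phi>' (F w) *\<^sub>R D F w)) \<and>
     (\<forall>n F \<phi> \<phi>'. (\<forall>i<n. F i \<in> A) \<and> C1b_n n \<phi> \<phi>' \<longrightarrow>
        (\<lambda>w. \<phi> (\<lambda>i. F i w)) \<in> DomD \<and>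
        (AE w in M. D (\<lambda>x. \<phi> (\<lambda>i. F i x)) w = (\<Sum>i<n. \<phi>' i (\<lambda>j. F j w) *\<^sub>R D (F i) w)))"

definition operator_factorization ::
  "'w measure \<Rightarrow> (('w \<Rightarrow> real) \<Rightarrow> ('w \<Rightarrow> 'h::real_inner)) \<Rightarrow> ('w \<Rightarrow> 'h) set \<Rightarrow>
   (('w \<Rightarrow> 'h) \<Rightarrow> ('w \<Rightarrow> real)) \<Rightarrow> (('w \<Rightarrow> 'h) \<Rightarrow> ('w \<Rightarrow> 'h)) \<Rightarrow> ('w \<Rightarrow> real) set \<Rightarrow> bool" where
  "operator_factorization M D Domdelta \<delta> Proj A \<longleftrightarrow>
     (\<forall>F\<in>A. Proj (D F) \<in> Domdelta \<and>
        (AE w in M. F w - (\<integral>x. F x \<partial>M) = \<delta> (Proj (D F)) w))"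

definition orthogonal_projection ::
  "'w measure \<Rightarrow> (('w \<Rightarrow> 'h::real_inner) \<Rightarrow> ('w \<Rightarrow> 'h)) \<Rightarrow> bool" where
  "orthogonal_projection M Proj \<longleftrightarrow> l2_adjoint M (l2_space M) Proj (l2_space M) Proj"

end

theory Submission
  imports Defs
begin

text \<open>
  For \<open>G\<close> in the algebra, the functions \<open>sin G\<close> separate points of \<open>L\<^sup>1\<close>, because \<open>G\<close> can approach an
  indicator function almost everywhere. It therefore suffices to test the identity against \<open>sin G\<close>.
  The product \<open>F sin G\<close> need not lie in the domain of \<open>D\<close>, but \<open>k sin (F/k) sin G\<close> is covered by the
  two-variable chain rule when \<open>F\<close> is in the algebra; duality with \<open>\<delta>\<close>, the core property and then
  \<open>k \<rightarrow> \<infinity>\<close> give the claim. In the last limit the term \<open>k sin (F/k) \<langle>D G, u\<rangle>\<close> is dominated by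
  \<open>\<bar>\<langle>D G, F u\<rangle>\<bar>\<close>, which is integrable because \<open>F u\<close> is square integrable.
\<close>

section \<open>Square-integrable functions\<close>

lemma l2_space_measurable: "f \<in> l2_space M \<Longrightarrow> f \<in> borel_measurable M"
  by (simp add: l2_space_def)

lemma l2_space_integrable_inner:
  fixes f g :: "'w \<Rightarrow> 'b::{real_inner, second_countable_topology}"
  assumes f: "f \<in> l2_space M" and g: "g \<in> l2_space M"
  shows "integrable M (\<lambda>w. f w \<bullet> g w)"
proof (rule Bochner_Integration.integrable_bound)
  show "integrable M (\<lambda>w. (norm (f w))\<^sup>2 + (norm (g w))\<^sup>2)"
    using f g by (simp add: l2_space_def)
  show "(\<lambda>w. f w \<bullet> g w) \<in> borel_measurable M"
    by (intro borel_measurable_inner l2_space_measurable f g)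
  have "\<bar>f w \<bullet> g w\<bar> \<le> (norm (f w))\<^sup>2 + (norm (g w))\<^sup>2" for w
    using Cauchy_Schwarz_ineq2[of "f w" "g w"] sum_squares_bound[of "norm (f w)" "norm (g w)"]
      mult_nonneg_nonneg[OF norm_ge_zero[of "f w"] norm_ge_zero[of "g w"]] by linarith
  then show "AE w in M. norm (f w \<bullet> g w) \<le> norm ((norm (f w))\<^sup>2 + (norm (g w))\<^sup>2)"
    by simp
qed

lemma l2_space_diff:
  fixes f g :: "'w \<Rightarrow> 'b::{real_inner, second_countable_topology}"
  assumes f: "f \<in> l2_space M" and g: "g \<in> l2_space M"
  shows "(\<lambda>w. f w - g w) \<in> l2_space M"
proof -
  have "integrable M (\<lambda>w. f w \<bullet> f w - 2 * (f w \<bullet> g w) + g w \<bullet> g w)"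
    using l2_space_integrable_inner[OF f f] l2_space_integrable_inner[OF f g]
      l2_space_integrable_inner[OF g g] by simp
  moreover have "(norm (f w - g w))\<^sup>2 = f w \<bullet> f w - 2 * (f w \<bullet> g w) + g w \<bullet> g w" for w
    by (simp add: power2_norm_eq_inner algebra_simps inner_commute)
  moreover have "(\<lambda>w. f w - g w) \<in> borel_measurable M"
    by (intro borel_measurable_diff l2_space_measurable f g)
  ultimately show ?thesis
    by (simp add: l2_space_def)
qed

lemma l2_norm_power2: "(l2_norm M f)\<^sup>2 = (\<integral>w. (norm (f w))\<^sup>2 \<partial>M)"
  by (simp add: l2_norm_def l2_inner_def power2_norm_eq_inner)

text \<open>Young's inequality with weight \<open>e\<close>, integrated: the first term contributes
  at most \<open>e * e / e = e\<close>, which explains the \<open>1\<close>. This stands in for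
  Cauchy-Schwarz in \<open>L\<^sup>2\<close>; a bound linear in \<open>e\<close> is enough, since
  \<open>e\<close> is sent to 0.\<close>

lemma integral_abs_inner_le_l2_norm:
  fixes f g :: "'w \<Rightarrow> 'b::{real_inner, second_countable_topology}"
  assumes f: "f \<in> l2_space M" and g: "g \<in> l2_space M" and e: "l2_norm M f \<le> e" "0 < e"
  shows "(\<integral>w. \<bar>f w \<bullet> g w\<bar> \<partial>M) \<le> e * (1 + (l2_norm M g)\<^sup>2)"
proof -
  have fi: "integrable M (\<lambda>w. (norm (f w))\<^sup>2)" and gi: "integrable M (\<lambda>w. (norm (g w))\<^sup>2)"
    using f g by (simp_all add: l2_space_def)
  have bound: "\<bar>f w \<bullet> g w\<bar> \<le> (norm (f w))\<^sup>2 / e + e * (norm (g w))\<^sup>2" for w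
  proof -
    \<comment> \<open>The weight \<open>e\<close> is placed on the second factor, so that dividing
      by \<open>e\<close> later gives the weighted inequality; the factor 2 is given away.\<close>
    have "2 * norm (f w) * (e * norm (g w)) \<le> (norm (f w))\<^sup>2 + (e * norm (g w))\<^sup>2"
      by (rule sum_squares_bound)
    moreover have "0 \<le> norm (f w) * (e * norm (g w))"
      using e by simp
    ultimately have "norm (f w) * norm (g w) * e \<le> (norm (f w))\<^sup>2 + e * (norm (g w))\<^sup>2 * e"
      by (simp add: power2_eq_square algebra_simps)
    then have "norm (f w) * norm (g w) \<le> (norm (f w))\<^sup>2 / e + e * (norm (g w))\<^sup>2"
      using e by (simp add: field_simps)
    then show ?thesis
      using Cauchy_Schwarz_ineq2[of "f w" "g w"] by linarith
  qed
  have "(\<integral>w. \<bar>f w \<bullet> g w\<bar> \<partial>M) \<le> (\<integral>w. (norm (f w))\<^sup>2 / e + e * (norm (g w))\<^sup>2 \<partial>M)"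
    by (rule integral_mono) (use fi gi bound l2_space_integrable_inner[OF f g] in auto)
  also have "\<dots> = (l2_norm M f)\<^sup>2 / e + e * (l2_norm M g)\<^sup>2"
    using fi gi by (simp add: l2_norm_power2)
  also have "(l2_norm M f)\<^sup>2 / e \<le> e"
  proof -
    have "0 \<le> l2_norm M f"
      by (simp add: l2_norm_def l2_inner_def)
    then have "(l2_norm M f)\<^sup>2 \<le> e * e"
      using e by (simp add: power2_eq_square mult_mono)
    then show ?thesis
      using e by (simp add: field_simps)
  qed
  finally show ?thesis
    by (simp add: algebra_simps)
qed

section \<open>Almost everywhere approximation\<close>

text \<open>The squared \<open>L\<^sup>2\<close> distance is the \<open>L\<^sup>1\<close> norm of
  the squared pointwise distance, and \<open>L\<^sup>1\<close> convergence yields an almost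
  everywhere convergent subsequence.\<close>

lemma l2_AE_subseq:
  fixes f :: "nat \<Rightarrow> 'w \<Rightarrow> 'b::{real_inner, second_countable_topology}"
  assumes f: "\<And>n. f n \<in> l2_space M" and g: "g \<in> l2_space M"
    and fg: "\<And>n. l2_norm M (\<lambda>w. g w - f n w) < inverse (real (Suc n))"
  shows "\<exists>r. strict_mono r \<and> (AE w in M. (\<lambda>n. f (r n) w) \<longlonglongrightarrow> g w)"
proof -
  have "(\<lambda>n. l2_norm M (\<lambda>w. g w - f n w)) \<longlonglongrightarrow> 0"
  proof (rule tendsto_sandwich[OF _ _ tendsto_const LIMSEQ_inverse_real_of_nat])
    show "\<forall>\<^sub>F n in sequentially. 0 \<le> l2_norm M (\<lambda>w. g w - f n w)"
      by (simp add: l2_norm_def l2_inner_def)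
    show "\<forall>\<^sub>F n in sequentially. l2_norm M (\<lambda>w. g w - f n w) \<le> inverse (real (Suc n))"
      by (intro always_eventually allI less_imp_le fg)
  qed
  then have "(\<lambda>n. (l2_norm M (\<lambda>w. g w - f n w))\<^sup>2) \<longlonglongrightarrow> 0\<^sup>2"
    by (rule tendsto_power)
  then have "(\<lambda>n. \<integral>w. norm ((norm (f n w - g w))\<^sup>2) \<partial>M) \<longlonglongrightarrow> 0"
    by (simp add: l2_norm_power2 norm_minus_commute)
  moreover have "integrable M (\<lambda>w. (norm (f n w - g w))\<^sup>2)" for n
    using l2_space_diff[OF f g] by (simp add: l2_space_def)
  ultimately obtain r where r: "strict_mono r"
      and ae: "AE w in M. (\<lambda>n. (norm (f (r n) w - g w))\<^sup>2) \<longlonglongrightarrow> 0"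
    using tendsto_L1_AE_subseq[of M "\<lambda>n w. (norm (f n w - g w))\<^sup>2"] by blast
  from ae have "AE w in M. (\<lambda>n. f (r n) w) \<longlonglongrightarrow> g w"
  proof eventually_elim
    case (elim w)
    then have "(\<lambda>n. sqrt ((norm (f (r n) w - g w))\<^sup>2)) \<longlonglongrightarrow> sqrt 0"
      by (rule tendsto_real_sqrt)
    then show ?case
      by (simp add: tendsto_norm_zero_iff LIM_zero_iff)
  qed
  with r show ?thesis by blast
qed

text \<open>Pointwise limits pass through the sine and through dominated convergence, hence density
  is turned into almost everywhere approximation.\<close>

lemma l2_dense_AE_seq:
  fixes g :: "'w \<Rightarrow> 'b::{real_inner, second_countable_topology}"
  assumes dense: "l2_dense M S" and g: "g \<in> l2_space M"
  shows "\<exists>f. (\<forall>n. f n \<in> S) \<and> (AE w in M. (\<lambda>n. f n w) \<longlonglongrightarrow> g w)"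
proof -
  have "\<exists>h\<in>S. l2_norm M (\<lambda>w. g w - h w) < inverse (real (Suc n))" for n
    using dense g unfolding l2_dense_def by simp
  then obtain f where fS: "\<And>n. f n \<in> S"
      and fn: "\<And>n. l2_norm M (\<lambda>w. g w - f n w) < inverse (real (Suc n))"
    by metis
  have "f n \<in> l2_space M" for n
    using fS dense unfolding l2_dense_def by blast
  then obtain r where "AE w in M. (\<lambda>n. f (r n) w) \<longlonglongrightarrow> g w"
    using l2_AE_subseq[of f M g] g fn by blast
  then show ?thesis
    using fS by (intro exI[of _ "\<lambda>n. f (r n)"]) auto
qed

text \<open>The two halves of graph norm density are used differently: the functions enter through
  nonlinear coefficients and should converge almost everywhere, whereas their images under
  \<open>T\<close> enter linearly and only need a rate in \<open>L\<^sup>2\<close>.\<close>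

lemma l2_core_AE_seq:
  fixes T :: "('w \<Rightarrow> 'a::{real_inner, second_countable_topology}) \<Rightarrow> ('w \<Rightarrow> 'b::real_inner)"
  assumes core: "l2_core M A S T" and S: "S \<subseteq> l2_space M" and g: "g \<in> S"
  shows "\<exists>f. (\<forall>n. f n \<in> A) \<and> (AE w in M. (\<lambda>n. f n w) \<longlonglongrightarrow> g w) \<and>
           (\<forall>n. l2_norm M (\<lambda>w. T g w - T (f n) w) < inverse (real (Suc n)))"
proof -
  have "\<exists>h\<in>A. l2_norm M (\<lambda>w. g w - h w) < inverse (real (Suc n)) \<and>
      l2_norm M (\<lambda>w. T g w - T h w) < inverse (real (Suc n))" for n
    using core g unfolding l2_core_def by simp
  then obtain f where fA: "\<And>n. f n \<in> A"
      and fn: "\<And>n. l2_norm M (\<lambda>w. g w - f n w) < inverse (real (Suc n))"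
      and Tf: "\<And>n. l2_norm M (\<lambda>w. T g w - T (f n) w) < inverse (real (Suc n))"
    by metis
  have "f n \<in> l2_space M" for n
    using fA core S unfolding l2_core_def by blast
  then obtain r where r: "strict_mono r" and ae: "AE w in M. (\<lambda>n. f (r n) w) \<longlonglongrightarrow> g w"
    using l2_AE_subseq[of f M g] g S fn by blast
  have "l2_norm M (\<lambda>w. T g w - T (f (r n)) w) < inverse (real (Suc n))" for n
  proof -
    \<comment> \<open>Since \<open>r n \<ge> n\<close>, the rate for the images survives the passage
      to the subsequence.\<close>
    have "inverse (real (Suc (r n))) \<le> inverse (real (Suc n))"
      using seq_suble[OF r, of n] by (intro le_imp_inverse_le) auto
    then show ?thesis
      using Tf[of "r n"] by linarith
  qed
  then show ?thesis
    using fA ae by (intro exI[of _ "\<lambda>n. f (r n)"]) auto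
qed

section \<open>Truncation by the sine\<close>

lemma C1b_sin: "C1b sin cos"
  unfolding C1b_def
  by (auto intro!: derivative_eq_intros continuous_intros boundedI[of _ 1])

text \<open>The function \<open>k * sin (x / k)\<close> is a smooth substitute for \<open>x\<close>,
  bounded by \<open>k\<close> and with derivative bounded by 1. The product with a second sine is
  therefore admissible in the two-variable chain rule, unlike the unbounded
  \<open>x 0 * sin (x 1)\<close>.\<close>

lemma C1b_n_scaled_sin_mult_sin:
  fixes k :: real
  assumes k: "0 < k"
  shows "C1b_n 2 (\<lambda>x. k * sin (x 0 / k) * sin (x 1))
    (\<lambda>i x. if i = 0 then cos (x 0 / k) * sin (x 1) else k * sin (x 0 / k) * cos (x 1))"
proof -
  have c: "continuous_on UNIV (\<lambda>x::nat \<Rightarrow> real. x i)" for i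
    by (rule continuous_on_product_coordinates)
  have cont: "continuous_on UNIV (\<lambda>x::nat \<Rightarrow> real. k * sin (x 0 / k) * sin (x 1))"
    "continuous_on UNIV (\<lambda>x::nat \<Rightarrow> real. cos (x 0 / k) * sin (x 1))"
    "continuous_on UNIV (\<lambda>x::nat \<Rightarrow> real. k * sin (x 0 / k) * cos (x 1))"
    using k by (auto intro!: continuous_intros c)
  have le1: "\<bar>a * b\<bar> \<le> 1" if "\<bar>a\<bar> \<le> 1" "\<bar>b\<bar> \<le> 1" for a b :: real
    using mult_mono[OF that] by (simp add: abs_mult)
  have lek: "\<bar>k * a * b\<bar> \<le> k" if "\<bar>a\<bar> \<le> 1" "\<bar>b\<bar> \<le> 1" for a b
    using le1[OF that] k by (simp add: abs_mult mult.assoc)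
  have bounded_rangeI: "bounded (range g)" if "\<And>x. \<bar>g x\<bar> \<le> c"
    for g :: "(nat \<Rightarrow> real) \<Rightarrow> real" and c
    using that by (intro boundedI[of _ c]) auto
  have bdd: "bounded (range (\<lambda>x::nat \<Rightarrow> real. k * sin (x 0 / k) * sin (x 1)))"
    "bounded (range (\<lambda>x::nat \<Rightarrow> real. cos (x 0 / k) * sin (x 1)))"
    "bounded (range (\<lambda>x::nat \<Rightarrow> real. k * sin (x 0 / k) * cos (x 1)))"
    by (rule bounded_rangeI, rule lek le1; simp)+
  have d0: "((\<lambda>t. k * sin (t / k) * sin b) has_real_derivative cos (a / k) * sin b) (at a)" for a b
    using k by (auto intro!: derivative_eq_intros)
  have d1: "((\<lambda>t. k * sin (a / k) * sin t) has_real_derivative k * sin (a / k) * cos b) (at b)" for a b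
    by (auto intro!: derivative_eq_intros)
  have two: "i < 2 \<longleftrightarrow> i = 0 \<or> i = 1" for i :: nat
    by auto
  show ?thesis
    unfolding C1b_n_def two using cont bdd d0 d1 by (auto simp: fun_upd_def)
qed

text \<open>Supplies a dominating function independent of \<open>k\<close> for the limit of large
  \<open>k\<close>.\<close>

lemma abs_scaled_sin_le:
  fixes k x :: real
  assumes "0 < k"
  shows "\<bar>k * sin (x / k)\<bar> \<le> \<bar>x\<bar>"
proof -
  have "k * \<bar>sin (x / k)\<bar> \<le> k * \<bar>x / k\<bar>"
    using assms abs_sin_x_le_abs_x[of "x / k"] by (intro mult_left_mono) auto
  then show ?thesis
    using assms by (simp add: abs_mult)
qed

text \<open>The sequence is the difference quotient of \<open>sin (x * t)\<close> at 0 along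
  \<open>t = 1 / (n + 1)\<close>; this view covers \<open>x = 0\<close> without a case
  split.\<close>

lemma tendsto_scaled_sin:
  fixes x :: real
  shows "(\<lambda>n. real (Suc n) * sin (x / real (Suc n))) \<longlonglongrightarrow> x"
proof -
  have "((\<lambda>t. sin (x * t)) has_real_derivative x) (at 0)"
    by (auto intro!: derivative_eq_intros)
  then have "((\<lambda>t. sin (x * t) / t) \<longlongrightarrow> x) (at 0)"
    by (simp add: has_field_derivative_iff)
  moreover have "filterlim (\<lambda>n. inverse (real (Suc n))) (at 0) sequentially"
    by (rule filterlim_atI[OF LIMSEQ_inverse_real_of_nat]) simp
  ultimately have "(\<lambda>n. sin (x * inverse (real (Suc n))) / inverse (real (Suc n))) \<longlonglongrightarrow> x"
    by (rule filterlim_compose)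
  then show ?thesis
    by (simp add: field_simps)
qed

lemma tendsto_cos_scaled: "(\<lambda>n. cos (x / real (Suc n))) \<longlonglongrightarrow> 1"
proof -
  have "(\<lambda>n. cos (x * inverse (real (Suc n)))) \<longlonglongrightarrow> cos (x * 0)"
    by (intro tendsto_intros LIMSEQ_inverse_real_of_nat)
  then show ?thesis
    by (simp add: divide_inverse)
qed

section \<open>The product rule for the divergence\<close>

context causal_triple
begin

lemma DomD_l2: "F \<in> DomD \<Longrightarrow> F \<in> l2_space M"
  and D_l2: "F \<in> DomD \<Longrightarrow> D F \<in> l2_space M"
  using D_closed unfolding l2_closed_operator_def l2_operator_def l2_subspace_def by blast+

lemma Domdelta_l2: "u \<in> Domdelta \<Longrightarrow> u \<in> l2_space M"
  and delta_l2: "u \<in> Domdelta \<Longrightarrow> \<delta> u \<in> l2_space M"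
  and delta_duality: "u \<in> Domdelta \<Longrightarrow> F \<in> DomD \<Longrightarrow>
    (\<integral>w. F w * \<delta> u w \<partial>M) = (\<integral>w. D F w \<bullet> u w \<partial>M)"
  using adjoint unfolding l2_adjoint_def l2_inner_def by auto

lemma l2_space_integrable:
  fixes f :: "'w \<Rightarrow> real"
  assumes "f \<in> l2_space M"
  shows "integrable M f"
proof -
  have "(\<lambda>w. 1::real) \<in> l2_space M"
    by (simp add: l2_space_def)
  from l2_space_integrable_inner[OF assms this] show ?thesis
    by simp
qed

section \<open>Duality for the truncated product\<close>

text \<open>The truncated product is a bounded \<open>C\<^sup>1\<close> function of
  \<open>(F, G)\<close>, so the two-variable chain rule puts it in \<open>DomD\<close> and computes
  its derivative; duality with \<open>u\<close> then gives the identity.\<close>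

lemma truncated_product_rule_core:
  assumes core: "chain_rule_core M DomD D A"
    and F: "F \<in> A" and G: "G \<in> A" and u: "u \<in> Domdelta" and k: "0 < k"
  shows "(\<integral>w. k * sin (F w / k) * sin (G w) * \<delta> u w \<partial>M) =
    (\<integral>w. cos (F w / k) * sin (G w) * (D F w \<bullet> u w) +
      k * sin (F w / k) * cos (G w) * (D G w \<bullet> u w) \<partial>M)"
proof -
  \<comment> \<open>The pair is coded as a family indexed by the naturals; its values beyond index 1
    are irrelevant for \<open>n = 2\<close>.\<close>
  define H where "H = (\<lambda>i::nat. if i = 0 then F else G)"
  have H: "\<forall>i<2. H i \<in> A"
    using F G by (simp add: H_def)
  have chain: "(\<lambda>w. \<phi> (\<lambda>i. H i w)) \<in> DomD \<and>
      (AE w in M. D (\<lambda>x. \<phi> (\<lambda>i. H i x)) w = (\<Sum>i<n. \<phi>' i (\<lambda>j. H j w) *\<^sub>R D (H i) w))"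
    if "(\<forall>i<n. H i \<in> A) \<and> C1b_n n \<phi> \<phi>'" for n H \<phi> \<phi>'
    using core that unfolding chain_rule_core_def by blast
  have dom: "(\<lambda>w. k * sin (F w / k) * sin (G w)) \<in> DomD"
    and D: "AE w in M. D (\<lambda>w. k * sin (F w / k) * sin (G w)) w =
      (cos (F w / k) * sin (G w)) *\<^sub>R D F w + (k * sin (F w / k) * cos (G w)) *\<^sub>R D G w"
    using chain[OF conjI[OF H C1b_n_scaled_sin_mult_sin[OF k]]]
    by (simp_all add: H_def lessThan_Suc numeral_2_eq_2 add.commute[of "_ *\<^sub>R D F _"])
  \<comment> \<open>Duality turns the left side into the integral of \<open>D\<close> of the
    truncated product against \<open>u\<close>, leaving an almost everywhere equality of
    integrands.\<close>
  show ?thesis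
    unfolding delta_duality[OF u dom]
  proof (rule integral_cong_AE)
    show "AE w in M. D (\<lambda>w. k * sin (F w / k) * sin (G w)) w \<bullet> u w =
      cos (F w / k) * sin (G w) * (D F w \<bullet> u w) + k * sin (F w / k) * cos (G w) * (D G w \<bullet> u w)"
      using D by eventually_elim (simp add: inner_add_left)
    have AD: "A \<subseteq> DomD"
      using core by (simp add: chain_rule_core_def l2_core_def)
    note [measurable] = l2_space_measurable[OF D_l2[OF dom]] l2_space_measurable[OF Domdelta_l2[OF u]]
      l2_space_measurable[OF DomD_l2[OF subsetD[OF AD F]]]
      l2_space_measurable[OF DomD_l2[OF subsetD[OF AD G]]]
      l2_space_measurable[OF D_l2[OF subsetD[OF AD F]]]
      l2_space_measurable[OF D_l2[OF subsetD[OF AD G]]]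
    show "(\<lambda>w. D (\<lambda>w. k * sin (F w / k) * sin (G w)) w \<bullet> u w) \<in> borel_measurable M"
      by measurable
    show "(\<lambda>w. cos (F w / k) * sin (G w) * (D F w \<bullet> u w) +
        k * sin (F w / k) * cos (G w) * (D G w \<bullet> u w)) \<in> borel_measurable M"
      by measurable
  qed
qed

text \<open>The core property carries the identity from the algebra to all of \<open>DomD\<close>:
  \<open>F\<close> is approximated in graph norm while \<open>G\<close> and \<open>k\<close> stay
  fixed.\<close>

lemma truncated_product_rule:
  assumes core: "chain_rule_core M DomD D A"
    and F: "F \<in> DomD" and G: "G \<in> A" and u: "u \<in> Domdelta" and k: "0 < k"
  shows "(\<integral>w. k * sin (F w / k) * sin (G w) * \<delta> u w \<partial>M) =
    (\<integral>w. cos (F w / k) * sin (G w) * (D F w \<bullet> u w) +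
      k * sin (F w / k) * cos (G w) * (D G w \<bullet> u w) \<partial>M)"
proof -
  have AD: "A \<subseteq> DomD" and lc: "l2_core M A DomD D"
    using core by (simp_all add: chain_rule_core_def l2_core_def)
  obtain f where fA: "\<And>n. f n \<in> A" and flim: "AE w in M. (\<lambda>n. f n w) \<longlonglongrightarrow> F w"
    and Df: "\<And>n. l2_norm M (\<lambda>w. D F w - D (f n) w) < inverse (real (Suc n))"
    using l2_core_AE_seq[OF lc _ F] DomD_l2 by (metis subsetI)
  have fD: "f n \<in> DomD" for n
    using fA AD by blast
  have GD: "G \<in> DomD"
    using G AD by blast
  note ul = Domdelta_l2[OF u]
  note [measurable] = l2_space_measurable[OF ul] l2_space_measurable[OF delta_l2[OF u]]
    l2_space_measurable[OF DomD_l2[OF F]] l2_space_measurable[OF D_l2[OF F]]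
    l2_space_measurable[OF DomD_l2[OF GD]] l2_space_measurable[OF D_l2[OF GD]]
    l2_space_measurable[OF DomD_l2[OF fD]] l2_space_measurable[OF D_l2[OF fD]]
  have DFu: "integrable M (\<lambda>w. D F w \<bullet> u w)" and DGu: "integrable M (\<lambda>w. D G w \<bullet> u w)"
    and Dfu: "\<And>n. integrable M (\<lambda>w. D (f n) w \<bullet> u w)"
    using l2_space_integrable_inner[OF D_l2 ul] F GD fD by blast+
  have du: "integrable M (\<delta> u)"
    by (rule l2_space_integrable[OF delta_l2[OF u]])
  have le1: "\<bar>a * b\<bar> \<le> 1" if "\<bar>a\<bar> \<le> 1" "\<bar>b\<bar> \<le> 1" for a b :: real
    using mult_mono[OF that] by (simp add: abs_mult)
  have scale: "\<bar>a * b * c\<bar> \<le> \<bar>c\<bar>" if "\<bar>a\<bar> \<le> 1" "\<bar>b\<bar> \<le> 1" for a b c :: real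
    using mult_right_mono[OF le1[OF that], of "\<bar>c\<bar>"] by (simp add: abs_mult)
  have scalek: "\<bar>k * a * b * c\<bar> \<le> k * \<bar>c\<bar>" if "\<bar>a\<bar> \<le> 1" "\<bar>b\<bar> \<le> 1" for a b c
    using mult_left_mono[OF scale[OF that], of k c] k by (simp add: abs_mult ac_simps)
  let ?L = "\<lambda>F w. k * sin (F w / k) * sin (G w) * \<delta> u w"
  let ?R = "\<lambda>F w. cos (F w / k) * sin (G w) * (D F w \<bullet> u w) +
      k * sin (F w / k) * cos (G w) * (D G w \<bullet> u w)"
  \<comment> \<open>In \<open>?R (f n)\<close> both the coefficients and \<open>D (f n)\<close>
    vary. The hybrid \<open>?S\<close> has the coefficients of \<open>f n\<close> but the limit
    derivative \<open>D F\<close>, which separates the two limits.\<close>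
  let ?S = "\<lambda>f w. cos (f w / k) * sin (G w) * (D F w \<bullet> u w) +
      k * sin (f w / k) * cos (G w) * (D G w \<bullet> u w)"
  \<comment> \<open>For fixed \<open>k\<close> the truncation is bounded by \<open>k\<close>
    uniformly in \<open>n\<close>, so \<open>k * \<bar>\<delta> u w\<bar>\<close> dominates.\<close>
  have L: "(\<lambda>n. \<integral>w. ?L (f n) w \<partial>M) \<longlonglongrightarrow> (\<integral>w. ?L F w \<partial>M)"
  proof (rule integral_dominated_convergence[where w = "\<lambda>w. k * \<bar>\<delta> u w\<bar>"])
    show "AE w in M. (\<lambda>n. ?L (f n) w) \<longlonglongrightarrow> ?L F w"
      using flim by eventually_elim (use k in \<open>auto intro!: tendsto_intros\<close>)
    show "AE w in M. norm (?L (f n) w) \<le> k * \<bar>\<delta> u w\<bar>" for n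
      using scalek by simp
  qed (use du in auto)
  have S: "(\<lambda>n. \<integral>w. ?S (f n) w \<partial>M) \<longlonglongrightarrow> (\<integral>w. ?R F w \<partial>M)"
  proof (rule integral_dominated_convergence[where
        w = "\<lambda>w. \<bar>D F w \<bullet> u w\<bar> + k * \<bar>D G w \<bullet> u w\<bar>"])
    show "AE w in M. (\<lambda>n. ?S (f n) w) \<longlonglongrightarrow> ?R F w"
      using flim by eventually_elim (use k in \<open>auto intro!: tendsto_intros\<close>)
    show "AE w in M. norm (?S (f n) w) \<le> \<bar>D F w \<bullet> u w\<bar> + k * \<bar>D G w \<bullet> u w\<bar>" for n
      unfolding real_norm_def by (intro AE_I2 order_trans[OF abs_triangle_ineq] add_mono scale scalek) auto
  qed (use DFu DGu in auto)
  \<comment> \<open>The \<open>D G\<close> terms cancel. What remains is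
    \<open>D F - D (f n)\<close> paired with \<open>u\<close>, with a coefficient of modulus at most
    1, and is controlled by the \<open>L\<^sup>2\<close> rate.\<close>
  have diff: "(\<lambda>n. (\<integral>w. ?S (f n) w \<partial>M) - (\<integral>w. ?R (f n) w \<partial>M)) \<longlonglongrightarrow> 0"
  proof (rule Lim_null_comparison)
    have Si: "integrable M (?S (f n))" for n
      by (rule Bochner_Integration.integrable_bound[where f = "\<lambda>w. \<bar>D F w \<bullet> u w\<bar> + k * \<bar>D G w \<bullet> u w\<bar>"])
        (use DFu DGu k in \<open>auto intro!: order_trans[OF abs_triangle_ineq] add_mono scale scalek\<close>)
    have Ri: "integrable M (?R (f n))" for n
      by (rule Bochner_Integration.integrable_bound[where f = "\<lambda>w. \<bar>D (f n) w \<bullet> u w\<bar> + k * \<bar>D G w \<bullet> u w\<bar>"])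
        (use Dfu DGu k in \<open>auto intro!: order_trans[OF abs_triangle_ineq] add_mono scale scalek\<close>)
    have "norm ((\<integral>w. ?S (f n) w \<partial>M) - (\<integral>w. ?R (f n) w \<partial>M))
        \<le> inverse (real (Suc n)) * (1 + (l2_norm M u)\<^sup>2)" for n
    proof -
      have dl: "(\<lambda>w. D F w - D (f n) w) \<in> l2_space M"
        by (rule l2_space_diff[OF D_l2[OF F] D_l2[OF fD]])
      have "norm ((\<integral>w. ?S (f n) w \<partial>M) - (\<integral>w. ?R (f n) w \<partial>M))
          \<le> (\<integral>w. norm (?S (f n) w - ?R (f n) w) \<partial>M)"
        unfolding Bochner_Integration.integral_diff[OF Si Ri, symmetric] by (rule integral_norm_bound)
      also have "\<dots> \<le> (\<integral>w. \<bar>(D F w - D (f n) w) \<bullet> u w\<bar> \<partial>M)"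
      proof (rule integral_mono)
        show "integrable M (\<lambda>w. norm (?S (f n) w - ?R (f n) w))"
          by (rule integrable_norm[OF Bochner_Integration.integrable_diff[OF Si Ri]])
        show "integrable M (\<lambda>w. \<bar>(D F w - D (f n) w) \<bullet> u w\<bar>)"
          using l2_space_integrable_inner[OF dl ul] by simp
        fix w
        have "?S (f n) w - ?R (f n) w = cos (f n w / k) * sin (G w) * ((D F w - D (f n) w) \<bullet> u w)"
          by (simp add: inner_diff_left algebra_simps)
        then show "norm (?S (f n) w - ?R (f n) w) \<le> \<bar>(D F w - D (f n) w) \<bullet> u w\<bar>"
          using scale[of "cos (f n w / k)" "sin (G w)"] by simp
      qed
      also have "\<dots> \<le> inverse (real (Suc n)) * (1 + (l2_norm M u)\<^sup>2)"
        using Df[of n] by (intro integral_abs_inner_le_l2_norm[OF dl ul]) auto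
      finally show ?thesis .
    qed
    then show "\<forall>\<^sub>F n in sequentially. norm ((\<integral>w. ?S (f n) w \<partial>M) - (\<integral>w. ?R (f n) w \<partial>M))
        \<le> inverse (real (Suc n)) * (1 + (l2_norm M u)\<^sup>2)"
      by simp
    show "(\<lambda>n. inverse (real (Suc n)) * (1 + (l2_norm M u)\<^sup>2)) \<longlonglongrightarrow> 0"
      using tendsto_mult_left_zero[OF LIMSEQ_inverse_real_of_nat] .
  qed
  have "(\<lambda>n. \<integral>w. ?R (f n) w \<partial>M) \<longlonglongrightarrow> (\<integral>w. ?R F w \<partial>M)"
    using tendsto_diff[OF S diff] by simp
  then have "(\<lambda>n. \<integral>w. ?L (f n) w \<partial>M) \<longlonglongrightarrow> (\<integral>w. ?R F w \<partial>M)"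
    using truncated_product_rule_core[OF core fA G u k] by simp
  with L show ?thesis
    by (rule LIMSEQ_unique)
qed

section \<open>Removing the truncation\<close>

text \<open>Letting \<open>k\<close> tend to infinity gives the product rule tested against
  \<open>sin G\<close>. Its cross term equals \<open>D (sin G)\<close> paired with
  \<open>F u\<close>, and a second use of duality, now for \<open>F u\<close>, makes
  \<open>\<delta> (F u)\<close> appear.\<close>

lemma integral_sin_product_rule:
  assumes core: "chain_rule_core M DomD D A"
    and F: "F \<in> DomD" and G: "G \<in> A" and u: "u \<in> Domdelta"
    and Fu: "(\<lambda>w. F w *\<^sub>R u w) \<in> Domdelta"
  shows "(\<integral>w. sin (G w) * (F w * \<delta> u w - D F w \<bullet> u w) \<partial>M) =
    (\<integral>w. sin (G w) * \<delta> (\<lambda>x. F x *\<^sub>R u x) w \<partial>M)"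
proof -
  have GD: "G \<in> DomD"
    using G core by (auto simp: chain_rule_core_def l2_core_def)
  note ul = Domdelta_l2[OF u]
  note [measurable] = l2_space_measurable[OF ul] l2_space_measurable[OF delta_l2[OF u]]
    l2_space_measurable[OF DomD_l2[OF F]] l2_space_measurable[OF D_l2[OF F]]
    l2_space_measurable[OF DomD_l2[OF GD]] l2_space_measurable[OF D_l2[OF GD]]
  have DFu: "integrable M (\<lambda>w. D F w \<bullet> u w)"
    by (rule l2_space_integrable_inner[OF D_l2[OF F] ul])
  \<comment> \<open>The scalar \<open>F\<close> is moved onto \<open>u\<close>: \<open>D G\<close>
    and \<open>F u\<close> are both square integrable, although \<open>F\<close> itself may be
    unbounded.\<close>
  have DGFu: "integrable M (\<lambda>w. F w * (D G w \<bullet> u w))"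
    using l2_space_integrable_inner[OF D_l2[OF GD] Domdelta_l2[OF Fu]] by simp
  have Fdu: "integrable M (\<lambda>w. F w * \<delta> u w)"
    using l2_space_integrable_inner[OF DomD_l2[OF F] delta_l2[OF u]] by simp
  let ?s = "\<lambda>n w. real (Suc n) * sin (F w / real (Suc n))"
  let ?c = "\<lambda>n w. cos (F w / real (Suc n))"
  have s: "\<bar>?s n w\<bar> \<le> \<bar>F w\<bar>" for n w
    by (rule abs_scaled_sin_le) simp
  have mult3: "\<bar>a * b * c\<bar> \<le> \<bar>a'\<bar> * \<bar>c\<bar>" if "\<bar>a\<bar> \<le> \<bar>a'\<bar>" "\<bar>b\<bar> \<le> 1" for a a' b c :: real
    using mult_right_mono[OF mult_mono[OF that], of "\<bar>c\<bar>"] by (simp add: abs_mult)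
  have "(\<lambda>n. \<integral>w. ?s n w * sin (G w) * \<delta> u w \<partial>M) \<longlonglongrightarrow> (\<integral>w. F w * sin (G w) * \<delta> u w \<partial>M)"
  proof (rule integral_dominated_convergence[where w = "\<lambda>w. \<bar>F w * \<delta> u w\<bar>"])
    show "AE w in M. (\<lambda>n. ?s n w * sin (G w) * \<delta> u w) \<longlonglongrightarrow> F w * sin (G w) * \<delta> u w"
      by (intro AE_I2 tendsto_intros tendsto_scaled_sin)
    show "AE w in M. norm (?s n w * sin (G w) * \<delta> u w) \<le> \<bar>F w * \<delta> u w\<bar>" for n
      unfolding real_norm_def abs_mult[of "F _"] by (intro AE_I2 mult3 s) simp
  qed (use Fdu in auto)
  \<comment> \<open>The explicit factor \<open>1\<close> is the limit of \<open>?c n\<close>;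
    keeping it lets the limit rules and \<open>mult3\<close> match both summands alike.\<close>
  moreover have "(\<lambda>n. \<integral>w. ?c n w * sin (G w) * (D F w \<bullet> u w) +
        ?s n w * cos (G w) * (D G w \<bullet> u w) \<partial>M)
      \<longlonglongrightarrow> (\<integral>w. 1 * sin (G w) * (D F w \<bullet> u w) + F w * cos (G w) * (D G w \<bullet> u w) \<partial>M)"
  proof (rule integral_dominated_convergence[where
        w = "\<lambda>w. \<bar>1::real\<bar> * \<bar>D F w \<bullet> u w\<bar> + \<bar>F w\<bar> * \<bar>D G w \<bullet> u w\<bar>"])
    show "AE w in M. (\<lambda>n. ?c n w * sin (G w) * (D F w \<bullet> u w) + ?s n w * cos (G w) * (D G w \<bullet> u w))
        \<longlonglongrightarrow> 1 * sin (G w) * (D F w \<bullet> u w) + F w * cos (G w) * (D G w \<bullet> u w)"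
      by (intro AE_I2 tendsto_intros tendsto_scaled_sin tendsto_cos_scaled)
    show "AE w in M. norm (?c n w * sin (G w) * (D F w \<bullet> u w) + ?s n w * cos (G w) * (D G w \<bullet> u w))
        \<le> \<bar>1::real\<bar> * \<bar>D F w \<bullet> u w\<bar> + \<bar>F w\<bar> * \<bar>D G w \<bullet> u w\<bar>" for n
      unfolding real_norm_def
      by (intro AE_I2 order_trans[OF abs_triangle_ineq] add_mono mult3 s) auto
    show "integrable M (\<lambda>w. \<bar>1::real\<bar> * \<bar>D F w \<bullet> u w\<bar> + \<bar>F w\<bar> * \<bar>D G w \<bullet> u w\<bar>)"
      using DFu integrable_abs[OF DGFu] by (simp add: abs_mult)
  qed auto
  \<comment> \<open>The truncated identity with \<open>k = n + 1\<close> says that the two sequences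
    coincide, hence so do their limits.\<close>
  ultimately have *: "(\<integral>w. F w * sin (G w) * \<delta> u w \<partial>M) =
      (\<integral>w. 1 * sin (G w) * (D F w \<bullet> u w) + F w * cos (G w) * (D G w \<bullet> u w) \<partial>M)"
    using truncated_product_rule[OF core F G u, of "real (Suc _)"] by (simp add: LIMSEQ_unique)
  have i1: "integrable M (\<lambda>w. F w * sin (G w) * \<delta> u w)"
    by (rule Bochner_Integration.integrable_bound[OF Fdu])
      (auto simp: abs_mult[of "F _" "\<delta> u _"] intro!: mult3)
  have i2: "integrable M (\<lambda>w. 1 * sin (G w) * (D F w \<bullet> u w))"
    by (rule Bochner_Integration.integrable_bound[OF DFu])
      (use mult3[of 1 1] in auto)
  have i3: "integrable M (\<lambda>w. F w * cos (G w) * (D G w \<bullet> u w))"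
    by (rule Bochner_Integration.integrable_bound[OF DGFu])
      (auto simp: abs_mult[of "F _" "_ \<bullet> _"] intro!: mult3)
  have "(\<integral>w. sin (G w) * (F w * \<delta> u w - D F w \<bullet> u w) \<partial>M) =
      (\<integral>w. F w * sin (G w) * \<delta> u w - 1 * sin (G w) * (D F w \<bullet> u w) \<partial>M)"
    by (simp add: algebra_simps)
  also have "\<dots> = (\<integral>w. F w * cos (G w) * (D G w \<bullet> u w) \<partial>M)"
    using * i1 i2 i3 by simp
  \<comment> \<open>The one-variable chain rule recognizes \<open>cos G\<close> times
    \<open>D G\<close> as the derivative of \<open>sin G\<close>.\<close>
  also have "\<dots> = (\<integral>w. D (\<lambda>x. sin (G x)) w \<bullet> (F w *\<^sub>R u w) \<partial>M)"
  proof (rule integral_cong_AE)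
    have sD: "(\<lambda>x. sin (G x)) \<in> DomD" and
      sG: "AE w in M. D (\<lambda>x. sin (G x)) w = cos (G w) *\<^sub>R D G w"
      using core G C1b_sin unfolding chain_rule_core_def by blast+
    note [measurable] = l2_space_measurable[OF D_l2[OF sD]]
    show "(\<lambda>w. D (\<lambda>x. sin (G x)) w \<bullet> F w *\<^sub>R u w) \<in> borel_measurable M"
      by measurable
    show "AE w in M. F w * cos (G w) * (D G w \<bullet> u w) = D (\<lambda>x. sin (G x)) w \<bullet> F w *\<^sub>R u w"
      using sG by eventually_elim simp
  qed measurable
  also have "\<dots> = (\<integral>w. sin (G w) * \<delta> (\<lambda>x. F x *\<^sub>R u x) w \<partial>M)"
    using core G C1b_sin unfolding chain_rule_core_def by (intro delta_duality[OF Fu, symmetric]) blast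
  finally show ?thesis .
qed

section \<open>Separation of integrable functions\<close>

text \<open>If elements of \<open>A\<close> converge almost everywhere to the indicator of
  \<open>B\<close>, their sines converge boundedly to \<open>sin 1\<close> times that indicator.
  Testing thus determines all integrals over measurable sets. Boundedness of the sine makes
  integrability of \<open>f\<close> and \<open>g\<close> sufficient.\<close>

lemma AE_eq_if_integral_sin_eq:
  fixes f g :: "'w \<Rightarrow> real"
  assumes dense: "l2_dense M A" and f: "integrable M f" and g: "integrable M g"
    and eq: "\<And>G. G \<in> A \<Longrightarrow> (\<integral>w. sin (G w) * f w \<partial>M) = (\<integral>w. sin (G w) * g w \<partial>M)"
  shows "AE w in M. f w = g w"
proof (rule density_unique_real[OF f g])
  fix B assume B [measurable]: "B \<in> sets M"
  have "(\<lambda>w. (norm (indicator B w :: real))\<^sup>2) = indicator B"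
    by (auto simp: indicator_def)
  then have "(indicator B :: 'w \<Rightarrow> real) \<in> l2_space M"
    by (simp add: l2_space_def less_top[symmetric])
  then obtain G where GA: "\<And>n. G n \<in> A" and G: "AE w in M. (\<lambda>n. G n w) \<longlonglongrightarrow> (indicator B w :: real)"
    using l2_dense_AE_seq[OF dense] by blast
  have [measurable]: "G n \<in> borel_measurable M" for n
    using GA dense unfolding l2_dense_def by (blast intro: l2_space_measurable)
  have lim: "(\<lambda>n. \<integral>w. sin (G n w) * h w \<partial>M) \<longlonglongrightarrow> sin 1 * (LINT w:B|M. h w)"
    if h: "integrable M h" for h
  proof -
    have [measurable]: "h \<in> borel_measurable M"
      using h by simp
    have "(\<lambda>n. \<integral>w. sin (G n w) * h w \<partial>M) \<longlonglongrightarrow> (\<integral>w. sin (indicator B w) * h w \<partial>M)"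
    proof (rule integral_dominated_convergence[where w = "\<lambda>w. \<bar>h w\<bar>"])
      show "AE w in M. (\<lambda>n. sin (G n w) * h w) \<longlonglongrightarrow> sin (indicator B w) * h w"
        using G by eventually_elim (auto intro!: tendsto_intros)
      show "AE w in M. norm (sin (G n w) * h w) \<le> \<bar>h w\<bar>" for n
        by (simp add: abs_mult mult_left_le_one_le)
    qed (use h in auto)
    \<comment> \<open>Off \<open>B\<close> this rests on \<open>sin 0 = 0\<close>.\<close>
    also have "(\<integral>w. sin (indicator B w) * h w \<partial>M) = (\<integral>w. sin 1 * (indicator B w * h w) \<partial>M)"
      by (rule Bochner_Integration.integral_cong) (auto simp: indicator_def)
    finally show ?thesis
      by (simp add: set_lebesgue_integral_def)
  qed
  have "sin 1 * (LINT w:B|M. f w) = sin 1 * (LINT w:B|M. g w)"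
    using LIMSEQ_unique[OF lim[OF f]] lim[OF g] eq[OF GA] by simp
  \<comment> \<open>Positivity, from \<open>0 < 1 < pi\<close>, allows the common factor to be
    cancelled.\<close>
  moreover have "sin (1::real) > 0"
    using pi_gt3 by (intro sin_gt_zero) auto
  ultimately show "(LINT w:B|M. f w) = (LINT w:B|M. g w)"
    by simp
qed

end

theorem theorem3p1:
  fixes M :: "'w measure"
    and T :: real
    and Filt :: "real \<Rightarrow> 'w measure"
    and D :: "('w \<Rightarrow> real) \<Rightarrow> ('w \<Rightarrow> 'h::{real_inner, complete_space, second_countable_topology})"
    and \<delta> :: "('w \<Rightarrow> 'h) \<Rightarrow> ('w \<Rightarrow> real)"
    and Proj :: "('w \<Rightarrow> 'h) \<Rightarrow> ('w \<Rightarrow> 'h)"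
    and DomD A :: "('w \<Rightarrow> real) set"
    and Domdelta :: "('w \<Rightarrow> 'h) set"
    and F :: "'w \<Rightarrow> real"
    and u :: "'w \<Rightarrow> 'h"
  assumes "causal_triple M T Filt DomD D Domdelta \<delta> Proj"
    and "chain_rule_core M DomD D A"
    and "operator_factorization M D Domdelta \<delta> Proj A"
    and "orthogonal_projection M Proj"
    and "F \<in> DomD"
    and "u \<in> Domdelta"
    and "(\<lambda>w. F w *\<^sub>R u w) \<in> l2_space M"
    and "(\<lambda>w. F w *\<^sub>R u w) \<in> Domdelta"
  shows "(\<lambda>w. F w * \<delta> u w - D F w \<bullet> u w) \<in> l2_space M \<and>
         (AE w in M. \<delta> (\<lambda>x. F x *\<^sub>R u x) w = F w * \<delta> u w - D F w \<bullet> u w)"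
proof -
  interpret causal_triple M T Filt DomD D Domdelta \<delta> Proj
    by fact
  note core = \<open>chain_rule_core M DomD D A\<close> and F = \<open>F \<in> DomD\<close> and u = \<open>u \<in> Domdelta\<close>
    and Fu = \<open>(\<lambda>w. F w *\<^sub>R u w) \<in> Domdelta\<close>
  let ?f = "\<lambda>w. F w * \<delta> u w - D F w \<bullet> u w"
  \<comment> \<open>Products of square-integrable functions are a priori only integrable, which is
    why the separation is carried out in \<open>L\<^sup>1\<close>.\<close>
  have f: "integrable M ?f"
    using l2_space_integrable_inner[OF DomD_l2[OF F] delta_l2[OF u]]
      l2_space_integrable_inner[OF D_l2[OF F] Domdelta_l2[OF u]] by simp
  have dl: "\<delta> (\<lambda>x. F x *\<^sub>R u x) \<in> l2_space M"
    by (rule delta_l2[OF Fu])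
  have ae: "AE w in M. \<delta> (\<lambda>x. F x *\<^sub>R u x) w = ?f w"
  proof (rule AE_eq_if_integral_sin_eq)
    show "l2_dense M A"
      using core by (simp add: chain_rule_core_def)
    show "(\<integral>w. sin (G w) * \<delta> (\<lambda>x. F x *\<^sub>R u x) w \<partial>M) = (\<integral>w. sin (G w) * ?f w \<partial>M)"
      if "G \<in> A" for G
      by (rule integral_sin_product_rule[OF core F that u Fu, symmetric])
  qed (use f l2_space_integrable[OF dl] in auto)
  \<comment> \<open>Square integrability of the right side is inherited from
    \<open>\<delta> (F u)\<close> through the almost everywhere equality.\<close>
  have "integrable M (\<lambda>w. (norm (\<delta> (\<lambda>x. F x *\<^sub>R u x) w))\<^sup>2)"
    using dl by (simp add: l2_space_def)
  then have "integrable M (\<lambda>w. (norm (?f w))\<^sup>2)"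
    by (rule integrable_cong_AE_imp) (use ae borel_measurable_integrable[OF f] in auto)
  then have "?f \<in> l2_space M"
    using f by (simp add: l2_space_def)
  with ae show ?thesis
    by simp
qed

end
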